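(* Let $K$ be a field of characteristic $p>0$, complete with respect to a nontrivial absolute value $|\cdot|$, and let $\lambda\in K$, $|\lambda|=1$. Then polynomials of the form \[ f(x)=\lambda x+a_{p+1}x^{p+1}\in K[x],\qquad a_{p+1}\neq 0, \] are not analytically linearizable at the fixed point at the origin if $|1-\lambda|<1$.
   Context: A power series $f(x)=\lambda x+\sum_{i\ge2}a_ix^i\in K[[x]]$ with $|\lambda|=1$ is analytically linearizable at the origin if there is a power series $g\in K[[x]]$ with $g(0)=0$, $g'(0)=1$ and positive radius of convergence solving the Schröder functional equation $g\circ f(x)=\lambda g(x)$. (An absolute value on a field of positive characteristic is necessarily non-Archimedean.) *)

theory Defs
  imports "HOL-Analysis.Analysis" "HOL-Computational_Algebra.Computational_Algebra"
begin

locale absolute_value =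
  fixes abv :: "'a::field \<Rightarrow> real"
  assumes abv_nonneg: "0 \<le> abv x"
    and abv_eq_0_iff: "abv x = 0 \<longleftrightarrow> x = 0"
    and abv_mult: "abv (x * y) = abv x * abv y"
    and abv_triangle: "abv (x + y) \<le> abv x + abv y"
begin

lemma abv_one: "abv 1 = 1"
  using abv_mult[of 1 1] abv_eq_0_iff[of 1] by simp

lemma abv_minus: "abv (- x) = abv x"
proof -
  have "abv (- 1) * abv (- 1) = 1"
    using abv_mult[of "- 1" "- 1"] abv_one by simp
  then have "abv (- 1) = 1"
    using abv_nonneg[of "- 1"] by (metis abs_of_nonneg abs_1 power2_eq_square power2_eq_1_iff
        abs_minus_cancel)
  then show ?thesis
    using abv_mult[of "- 1" x] by simp
qed

sublocale Metric_space UNIV "\<lambda>x y. abv (x - y)"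
proof
  show "0 \<le> abv (x - y)" for x y
    by (rule abv_nonneg)
  show "abv (x - y) = abv (y - x)" for x y
    using abv_minus[of "x - y"] by simp
  show "abv (x - y) = 0 \<longleftrightarrow> x = y" for x y
    by (simp add: abv_eq_0_iff)
  show "abv (x - z) \<le> abv (x - y) + abv (y - z)" for x y z
    using abv_triangle[of "x - y" "y - z"] by simp
qed

end

definition nontrivial_abv :: "('a::field \<Rightarrow> real) \<Rightarrow> bool" where
  "nontrivial_abv abv \<longleftrightarrow> (\<exists>x. x \<noteq> 0 \<and> abv x \<noteq> 1)"

definition complete_abv :: "('a::field \<Rightarrow> real) \<Rightarrow> bool" where
  "complete_abv abv \<longleftrightarrow> Metric_space.mcomplete UNIV (\<lambda>x y. abv (x - y))"

text \<open>
  The library's \<open>conv_radius\<close> of the real sequence of absolute values of the coefficients is,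
  by definition, \<open>1 / limsup |g_n| ^ (1/n)\<close>, the radius of convergence of \<open>g\<close> with respect to
  \<open>abv\<close>; the library's \<open>fps_conv_radius\<close> is not available for fields of positive characteristic.
\<close>
definition abv_conv_radius :: "('a::field \<Rightarrow> real) \<Rightarrow> 'a fps \<Rightarrow> ereal" where
  "abv_conv_radius abv g = conv_radius (\<lambda>n. abv (fps_nth g n))"

text \<open>
  Intended for series \<open>f\<close> with \<open>f(0) = 0\<close>, for which \<open>oo\<close> is composition of power series;
  the multiplier \<open>\<lambda>\<close> of the fixed point is the linear coefficient of \<open>f\<close>.
\<close>
definition analytically_linearizable :: "('a::field \<Rightarrow> real) \<Rightarrow> 'a fps \<Rightarrow> bool" where
  "analytically_linearizable abv f \<longleftrightarrow>
     (\<exists>g. fps_nth g 0 = 0 \<and> fps_nth g 1 = 1 \<and> 0 < abv_conv_radius abv g \<and>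
          g oo f = fps_const (fps_nth f 1) * g)"

end

theory Submission
  imports Defs
begin

text \<open>
  Write \<open>b\<^sub>n\<close> for the coefficients of a formal linearization \<open>g\<close> of
  \<open>f(x) = \<lambda> x + a x\<^bsup>p+1\<^esup>\<close>. Since \<open>f\<close> is \<open>x\<close> times a polynomial in \<open>x\<^bsup>p\<^esup>\<close>, the
  Schroeder equation relates the coefficients at the exponents \<open>1 + p m\<close> only to one another, and
  solving for the last of them introduces the divisor \<open>1 - \<lambda>\<^bsup>pm\<^esup>\<close>
  (\<open>schroeder_recursion\<close>).

  The usual obstacle to proving divergence is that the terms of such a recursion may cancel. Here
  they cannot. As \<open>1 + p (m - 1) \<equiv> 1\<close> modulo \<open>p\<close>, the term with \<open>b\<^bsub>1+p(m-1)\<^esub>\<close> carries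
  the factor \<open>a\<close> times a power of \<open>\<lambda>\<close>, while all other binomial coefficients have absolute value
  at most 1. Every divisor has absolute value less than 1, so that, inductively,
  \<open>|b\<^bsub>1+pm\<^esub>| / |a|\<^bsup>m\<^esup>\<close> strictly increases; hence that term strictly dominates, and by the
  ultrametric inequality nothing cancels (\<open>schroeder_dominant_term\<close>). Consequently
  \<open>|b\<^bsub>1+pm\<^esub>| \<cdot> \<Prod>\<^bsub>j\<le>m\<^esub> |1 - \<lambda>\<^bsup>pj\<^esup>| = |a|\<^bsup>m\<^esup>\<close>
  holds exactly (\<open>coeff_times_small_divisors\<close>).

  In characteristic \<open>p\<close> the divisors are tiny: \<open>1 - \<lambda>\<^bsup>pj\<^esup> = (1 - \<lambda>\<^bsup>j\<^esup>)\<^bsup>p\<^esup>\<close>, so a factor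
  \<open>p\<^bsup>v\<^esup>\<close> in \<open>j\<close> raises \<open>|1 - \<lambda>| < 1\<close> to the power \<open>p\<^bsup>v+1\<^esup>\<close>. For \<open>\<lambda> \<noteq> 1\<close> no single divisor
  spoils the convergence, but each of the \<open>s\<close> scales \<open>v < s\<close> contributes an exponent of order \<open>m\<close> to the
  product up to \<open>m = p\<^bsup>s\<^esup>\<close>, which is therefore at most \<open>|1 - \<lambda>|\<^bsup>sm\<^esup>\<close>
  (\<open>prod_small_divisors_le\<close>). This beats every exponential bound on the coefficients, so the radius
  of convergence is 0. The case \<open>\<lambda> = 1\<close> needs no separate treatment: the product then vanishes,
  contradicting \<open>a \<noteq> 0\<close>.
\<close>

locale prime_char_absolute_value = absolute_value abv
  for abv :: "'a::field \<Rightarrow> real" +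
  fixes p :: nat
  assumes char: "CHAR('a) = p" and prime_p: "prime p"
begin

lemma p_gt_1: "p > 1"
  using prime_p prime_gt_1_nat by blast

lemma abv_zero: "abv 0 = 0"
  by (simp add: abv_eq_0_iff)

lemma abv_power: "abv (x ^ n) = abv x ^ n"
  by (induction n) (simp_all add: abv_one abv_mult)

section \<open>The ultrametric inequality\<close>

text \<open>
  By the freshman's dream, the triangle inequality applied to \<open>p\<^bsup>n\<^esup>\<close>-th powers loses only a factor
  2, and taking \<open>p\<^bsup>n\<^esup>\<close>-th roots makes this factor tend to 1.
\<close>
lemma ultrametric: "abv (x + y) \<le> max (abv x) (abv y)"
proof (rule ccontr)
  define M where "M = max (abv x) (abv y)"
  assume "\<not> ?thesis"
  then have M: "M < abv (x + y)" "0 \<le> M"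
    by (auto simp: M_def le_max_iff_disj abv_nonneg)
  have bound: "abv (x + y) ^ (p ^ n) \<le> 2 * M ^ (p ^ n)" for n
  proof -
    have "abv (x + y) ^ (p ^ n) = abv (x ^ (p ^ n) + y ^ (p ^ n))"
      by (subst freshmans_dream'[of "p ^ n" n, symmetric]) (simp_all only: char prime_p abv_power)
    also have "\<dots> \<le> abv x ^ (p ^ n) + abv y ^ (p ^ n)"
      using abv_triangle[of "x ^ (p ^ n)" "y ^ (p ^ n)"] by (simp add: abv_power)
    also have "\<dots> \<le> M ^ (p ^ n) + M ^ (p ^ n)"
      by (intro add_mono power_mono) (auto simp: M_def abv_nonneg)
    finally show ?thesis by simp
  qed
  show False
  proof (cases "M = 0")
    case True
    then show False using bound[of 0] M p_gt_1 by simp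
  next
    case False
    define q where "q = abv (x + y) / M"
    have "1 < q" using M False by (simp add: q_def)
    then obtain n where "2 < q ^ n" using real_arch_pow by blast
    also have "n \<le> p ^ n"
      using power_gt_expt[of p n] p_gt_1 by simp
    then have "q ^ n \<le> q ^ (p ^ n)"
      using \<open>1 < q\<close> by (intro power_increasing) auto
    also have "\<dots> \<le> 2"
      using bound[of n] M False by (simp add: q_def power_divide field_simps)
    finally show False by simp
  qed
qed

lemma abv_of_nat_le_1: "abv (of_nat n) \<le> 1"
proof (induction n)
  case (Suc n)
  then show ?case using ultrametric[of 1 "of_nat n"] by (simp add: abv_one)
qed (simp add: abv_zero)

lemma abv_sum_less:
  assumes "\<And>i. i \<in> A \<Longrightarrow> abv (f i) < c" and "0 < c"
  shows "abv (sum f A) < c"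
  using assms
proof (induction A rule: infinite_finite_induct)
  case (insert i A)
  then have "abv (f i) < c" "abv (sum f A) < c" by auto
  then show ?case using insert.hyps ultrametric[of "f i" "sum f A"] by simp
qed (auto simp: abv_zero)

lemma abv_add_eq_dominant:
  assumes "abv y < abv x"
  shows "abv (x + y) = abv x"
proof (rule antisym)
  show "abv (x + y) \<le> abv x"
    using ultrametric[of x y] assms by simp
  show "abv x \<le> abv (x + y)"
    using ultrametric[of "x + y" "- y"] assms by (simp add: abv_minus)
qed

lemma abv_sum_le_1:
  assumes "\<And>i. i \<in> A \<Longrightarrow> abv (f i) \<le> 1"
  shows "abv (sum f A) \<le> 1"
  using assms
proof (induction A rule: infinite_finite_induct)
  case (insert i A)
  then have "abv (f i) \<le> 1" "abv (sum f A) \<le> 1" by auto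
  then show ?case using insert.hyps ultrametric[of "f i" "sum f A"] by simp
qed (auto simp: abv_zero)

section \<open>Small divisors\<close>

text \<open>The cofactor \<open>1 + x + \<dots> + x\<^bsup>n-1\<^esup>\<close> of \<open>1 - x\<close> is integral.\<close>
lemma abv_one_minus_power_le:
  assumes "abv x \<le> 1"
  shows "abv (1 - x ^ n) \<le> abv (1 - x)"
proof -
  have "abv (\<Sum>i<n. x ^ i) \<le> 1"
    using assms by (intro abv_sum_le_1) (simp add: abv_power power_le_one abv_nonneg)
  then show ?thesis
    using mult_left_le[OF _ abv_nonneg] by (simp add: one_diff_power_eq abv_mult)
qed

lemma abv_one_minus_power_char: "abv (1 - x ^ (p * n)) = abv (1 - x ^ n) ^ p"
proof -
  have "(1 - x ^ n + x ^ n) ^ p = (1 - x ^ n) ^ p + (x ^ n) ^ p"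
    by (rule freshmans_dream) (simp_all only: char prime_p)
  then have "1 = (1 - x ^ n) ^ p + x ^ (p * n)"
    by (simp only: diff_add_cancel power_one power_mult mult.commute[of p n])
  then have "1 - x ^ (p * n) = (1 - x ^ n) ^ p"
    by (metis add_diff_cancel_right')
  then show ?thesis by (simp add: abv_power)
qed

text \<open>
  Induction on \<open>s\<close>. Among the indices up to \<open>p \<cdot> p\<^bsup>s\<^esup>\<close>, the multiples of \<open>p\<close> reproduce the \<open>p\<close>-th
  power of the product for \<open>s\<close>, while each of the at least \<open>p\<^bsup>s\<^esup>\<close> other indices contributes a factor
  of at most \<open>|1 - x|\<^bsup>p\<^esup>\<close>; the latter raise the exponent from \<open>s p\<^bsup>s+1\<^esup>\<close> to
  \<open>(s + 1) p\<^bsup>s+1\<^esup>\<close>.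
\<close>
lemma prod_small_divisors_le:
  assumes "abv x = 1" and "abv (1 - x) < 1"
  shows "(\<Prod>j=1..p ^ s. abv (1 - x ^ (p * j))) \<le> abv (1 - x) ^ (s * p ^ s)"
proof (induction s)
  case 0
  show ?case
    using abv_one_minus_power_le[of x p] assms by simp
next
  case (Suc s)
  define N where "N = p ^ s"
  define r where "r = abv (1 - x)"
  define d where "d j = abv (1 - x ^ (p * j))" for j
  have r: "0 \<le> r" "r \<le> 1"
    using assms by (auto simp: r_def abv_nonneg)
  have d_nonneg: "0 \<le> d j" for j by (simp add: d_def abv_nonneg)
  have d_le: "d j \<le> r ^ p" for j
    unfolding d_def r_def abv_one_minus_power_char
    using assms by (intro power_mono abv_one_minus_power_le abv_nonneg) simp
  define A where "A = {1..p * N}"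
  define D where "D = (*) p ` {1..N}"
  have "N > 0" using p_gt_1 by (simp add: N_def)
  have inj: "inj_on ((*) p) {1..N}" using p_gt_1 by (auto simp: inj_on_def)
  have D: "D \<subseteq> A" "card D = N"
    using p_gt_1 inj by (auto simp: D_def A_def card_image)
  have card: "N \<le> card (A - D)"
  proof -
    have "card (A - D) = p * N - N"
      using D by (simp add: card_Diff_subset finite_subset[of D A] A_def)
    moreover have "2 * N \<le> p * N" using p_gt_1 by (intro mult_right_mono) auto
    ultimately show ?thesis by linarith
  qed
  have d_mult: "d (p * j) = d j ^ p" for j
    unfolding d_def by (rule abv_one_minus_power_char)
  have "prod d A = prod d (A - D) * prod d D"
    using D by (simp add: prod.subset_diff A_def)
  also have "\<dots> \<le> r ^ (p * N) * (r ^ (s * N)) ^ p"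
  proof (rule mult_mono)
    have "prod d (A - D) \<le> (\<Prod>j\<in>A - D. r ^ p)"
      by (intro prod_mono) (simp add: d_nonneg d_le)
    also have "\<dots> = r ^ (p * card (A - D))"
      by (simp add: power_mult)
    also have "\<dots> \<le> r ^ (p * N)"
      using r card by (intro power_decreasing) auto
    finally show "prod d (A - D) \<le> r ^ (p * N)" .
    have "prod d D = (\<Prod>j=1..N. d (p * j))"
      by (simp only: D_def prod.reindex[OF inj] o_def)
    also have "\<dots> = (\<Prod>j=1..N. d j) ^ p"
      by (simp only: d_mult prod_power_distrib)
    also have "\<dots> \<le> (r ^ (s * N)) ^ p"
      using Suc.IH by (intro power_mono prod_nonneg) (auto simp: d_def r_def N_def abv_nonneg)
    finally show "prod d D \<le> (r ^ (s * N)) ^ p" .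
  qed (auto intro!: prod_nonneg simp: d_nonneg r)
  also have "\<dots> = r ^ (p * N + s * N * p)"
    by (simp add: power_add flip: power_mult)
  also have "p * N + s * N * p = Suc s * p ^ Suc s"
    by (simp add: N_def algebra_simps)
  finally show ?case by (simp only: A_def d_def r_def N_def power_Suc)
qed

end

section \<open>The Schroeder equation\<close>

lemma fps_nth_power_binomial_sparse:
  fixes lam a :: "'a::comm_ring_1"
  assumes "p > 0"
  shows "fps_nth ((fps_const lam * fps_X + fps_const a * fps_X ^ (p + 1)) ^ l) n =
    (if l \<le> n \<and> p dvd n - l
     then of_nat (l choose ((n - l) div p)) * lam ^ (l - (n - l) div p) * a ^ ((n - l) div p)
     else 0)"
proof -
  let ?f = "fps_const lam * fps_X + fps_const a * fps_X ^ (p + 1)"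
  have "?f = fps_X * (fps_const a * fps_X ^ p + fps_const lam)"
    by (simp add: algebra_simps)
  then have "?f ^ l = fps_X ^ l * (fps_const a * fps_X ^ p + fps_const lam) ^ l"
    by (simp only: power_mult_distrib)
  also have "(fps_const a * fps_X ^ p + fps_const lam) ^ l =
      (\<Sum>k\<le>l. fps_const (of_nat (l choose k) * a ^ k * lam ^ (l - k)) * fps_X ^ (p * k))"
    unfolding binomial_ring
    by (intro sum.cong refl)
       (simp add: power_mult_distrib fps_const_power mult_ac
          flip: power_mult fps_const_mult fps_of_nat)
  finally have "fps_nth (?f ^ l) n = (if n < l then 0 else
      \<Sum>k\<le>l. of_nat (l choose k) * a ^ k * lam ^ (l - k) * (if n - l = p * k then 1 else 0))"
    by (simp add: fps_X_power_mult_nth fps_sum_nth)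
  also have "\<dots> = (if l \<le> n \<and> p dvd n - l
     then of_nat (l choose ((n - l) div p)) * lam ^ (l - (n - l) div p) * a ^ ((n - l) div p)
     else 0)"
  proof (cases "l \<le> n \<and> p dvd n - l")
    case True
    then obtain i where i: "n - l = p * i" by blast
    have "(\<Sum>k\<le>l. of_nat (l choose k) * a ^ k * lam ^ (l - k) * (if n - l = p * k then 1 else 0))
        = (\<Sum>k\<le>l. if i = k then of_nat (l choose k) * a ^ k * lam ^ (l - k) else 0)"
      using assms i by (intro sum.cong) auto
    also have "\<dots> = of_nat (l choose i) * a ^ i * lam ^ (l - i)"
      by (auto simp: binomial_eq_0)
    finally show ?thesis using True i assms by (simp add: mult_ac)
  next
    case False
    then show ?thesis by (auto intro!: sum.neutral)
  qed
  finally show ?thesis .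
qed

text \<open>
  Only the powers \<open>f\<^bsup>l\<^esup>\<close> with \<open>l = 1 + p (m - i)\<close> meet the exponent \<open>1 + p m\<close>. The term \<open>i = 0\<close>,
  which is \<open>\<lambda>\<^bsup>1+pm\<^esup> b\<^bsub>1+pm\<^esub>\<close>, has been moved to the left-hand side.
\<close>
lemma schroeder_recursion:
  fixes lam a :: "'a::comm_ring_1"
  assumes "p > 1"
    and eq: "g oo (fps_const lam * fps_X + fps_const a * fps_X ^ (p + 1)) = fps_const lam * g"
  shows "lam * (1 - lam ^ (p * m)) * fps_nth g (1 + p * m) =
    (\<Sum>i=1..m. of_nat ((1 + p * (m - i)) choose i) * lam ^ (1 + p * (m - i) - i) * a ^ i
       * fps_nth g (1 + p * (m - i)))"
proof -
  define n where "n = 1 + p * m"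
  let ?f = "fps_const lam * fps_X + fps_const a * fps_X ^ (p + 1)"
  let ?h = "\<lambda>i. 1 + p * (m - i)"
  let ?T = "\<lambda>i. of_nat (?h i choose i) * lam ^ (?h i - i) * a ^ i * fps_nth g (?h i)"
  have nth: "fps_nth (?f ^ l) n =
    (if l \<le> n \<and> p dvd n - l
     then of_nat (l choose ((n - l) div p)) * lam ^ (l - (n - l) div p) * a ^ ((n - l) div p)
     else 0)" for l
    using assms(1) by (intro fps_nth_power_binomial_sparse) simp
  have n_minus: "n - ?h i = p * i" if "i \<le> m" for i
    using that by (simp add: n_def diff_mult_distrib2)
  have range: "l \<in> ?h ` {0..m}" if l: "l \<le> n" "p dvd n - l" for l
  proof -
    obtain i where i: "n - l = p * i" using l(2) by blast
    have "i \<le> m"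
    proof (rule ccontr)
      assume "\<not> i \<le> m"
      then have "p * (m + 1) \<le> p * i" by (intro mult_left_mono) auto
      then show False using i l assms(1) by (simp add: n_def)
    qed
    then have "l = ?h i"
      using i l(1) mult_le_mono2[OF \<open>i \<le> m\<close>, of p] unfolding n_def diff_mult_distrib2
      by linarith
    then show ?thesis using \<open>i \<le> m\<close> by auto
  qed
  have inj: "inj_on ?h {0..m}"
    using assms(1) by (auto simp: inj_on_def)
  have "lam * fps_nth g n = fps_nth (g oo ?f) n"
    by (simp only: eq fps_mult_left_const_nth)
  also have "\<dots> = (\<Sum>l\<in>{0..n}. fps_nth g l * fps_nth (?f ^ l) n)"
    by (rule fps_compose_nth)
  also have "\<dots> = (\<Sum>l\<in>?h ` {0..m}. fps_nth g l * fps_nth (?f ^ l) n)"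
  proof (intro sum.mono_neutral_right ballI)
    fix l assume "l \<in> {0..n} - ?h ` {0..m}"
    then have "\<not> (l \<le> n \<and> p dvd n - l)" using range by blast
    then show "fps_nth g l * fps_nth (?f ^ l) n = 0" by (simp only: nth) simp
  qed (auto simp: n_def)
  also have "\<dots> = (\<Sum>i\<in>{0..m}. fps_nth g (?h i) * fps_nth (?f ^ ?h i) n)"
    by (simp only: sum.reindex[OF inj] o_def)
  also have "\<dots> = (\<Sum>i\<in>{0..m}. ?T i)"
  proof (intro sum.cong refl)
    fix i assume "i \<in> {0..m}"
    then have "n - ?h i = p * i" "?h i \<le> n"
      using n_minus by (simp_all only: atLeastAtMost_iff) (simp add: n_def)
    then show "fps_nth g (?h i) * fps_nth (?f ^ ?h i) n = ?T i"
      using assms(1) by (simp only: nth) (simp add: mult_ac)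
  qed
  also have "\<dots> = lam ^ n * fps_nth g n + (\<Sum>i=1..m. ?T i)"
    by (simp add: sum.atLeast_Suc_atMost n_def)
  finally show ?thesis by (simp add: n_def algebra_simps)
qed

section \<open>Growth of the coefficients of the linearization\<close>

context prime_char_absolute_value
begin

context
  fixes lam a :: 'a and g :: "'a fps"
  assumes lam: "abv lam = 1" "abv (1 - lam) < 1" and a: "a \<noteq> 0"
    and g1: "fps_nth g 1 = 1"
    and eq: "g oo (fps_const lam * fps_X + fps_const a * fps_X ^ (p + 1)) = fps_const lam * g"
begin

text \<open>
  The first conjunct says that the term \<open>i = 1\<close> alone determines the absolute value of the sum in
  \<open>schroeder_recursion\<close>. Its proof needs the strict growth of the earlier coefficients, and it yields
  the strict growth of the next one because \<open>|1 - \<lambda>\<^bsup>p(m+1)\<^esup>| < 1\<close>; hence the joint induction.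
\<close>
lemma schroeder_dominant_term:
  "abv (1 - lam ^ (p * Suc m)) * abv (fps_nth g (1 + p * Suc m)) =
     abv a * abv (fps_nth g (1 + p * m)) \<and>
   0 < abv a * abv (fps_nth g (1 + p * m)) \<and>
   abv a * abv (fps_nth g (1 + p * m)) < abv (fps_nth g (1 + p * Suc m))"
proof (induction m rule: less_induct)
  case (less m)
  define B where "B k = abv (fps_nth g (1 + p * k))" for k
  have a_pos: "0 < abv a"
    using a abv_eq_0_iff[of a] abv_nonneg[of a] by simp
  have IH: "abv a * B k < B (Suc k)" if "k < m" for k
    using less.IH[OF that] by (simp add: B_def)
  have B_pos: "0 < B m"
  proof (cases m)
    case 0
    then show ?thesis using g1 by (simp add: B_def abv_one)
  next
    case (Suc k)
    have "0 \<le> abv a * B k" by (simp add: B_def abv_nonneg)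
    then show ?thesis using IH[of k] Suc by simp
  qed
  \<comment> \<open>Iterating the strict growth makes every earlier coefficient negligible against \<open>B m\<close>.\<close>
  have smaller: "abv a ^ Suc i * B (m - i) < abv a * B m" if "1 \<le> i" "i \<le> m" for i
    using that
  proof (induction i rule: nat_induct_at_least)
    case base
    then show ?case using IH[of "m - 1"] a_pos by (simp add: mult.assoc)
  next
    case (Suc i)
    then have "Suc (m - Suc i) = m - i" by simp
    then have "abv a ^ Suc i * (abv a * B (m - Suc i)) < abv a ^ Suc i * B (m - i)"
      using IH[of "m - Suc i"] Suc a_pos by (intro mult_strict_left_mono) auto
    then show ?case using Suc by (simp add: mult_ac)
  qed
  define T where "T i = of_nat ((1 + p * (Suc m - i)) choose i) * lam ^ (1 + p * (Suc m - i) - i)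
      * a ^ i * fps_nth g (1 + p * (Suc m - i))" for i
  have T_le: "abv (T i) \<le> abv a ^ i * B (Suc m - i)" for i
  proof -
    have "abv (T i) = abv (of_nat ((1 + p * (Suc m - i)) choose i)) * (abv a ^ i * B (Suc m - i))"
      by (simp add: T_def B_def abv_mult abv_power lam mult_ac)
    also have "\<dots> \<le> 1 * (abv a ^ i * B (Suc m - i))"
      by (intro mult_right_mono abv_of_nat_le_1) (simp add: B_def abv_nonneg)
    finally show ?thesis by simp
  qed
  \<comment> \<open>The binomial coefficient of this term is \<open>1 + p m\<close>, which is 1 in the field.\<close>
  have T1: "abv (T 1) = abv a * B m"
  proof -
    have "of_nat p = (0 :: 'a)" using char of_nat_CHAR by metis
    then show ?thesis by (simp add: T_def B_def abv_mult abv_power lam)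
  qed
  have "abv (sum T {2..Suc m}) < abv a * B m"
  proof (rule abv_sum_less)
    fix i assume i: "i \<in> {2..Suc m}"
    then obtain k where k: "i = Suc k" "1 \<le> k" "k \<le> m" by (cases i) auto
    then show "abv (T i) < abv a * B m"
      using T_le[of i] smaller[of k] by simp
  qed (simp add: a_pos B_pos)
  then have dominant: "abv (T 1 + sum T {2..Suc m}) = abv a * B m"
    using T1 abv_add_eq_dominant by simp
  have "lam * (1 - lam ^ (p * Suc m)) * fps_nth g (1 + p * Suc m) = sum T {1..Suc m}"
    unfolding T_def by (rule schroeder_recursion[OF p_gt_1 eq])
  also have "\<dots> = T 1 + sum T {2..Suc m}"
    by (subst sum.atLeast_Suc_atMost) (auto simp: numeral_2_eq_2)
  finally have "abv (lam * (1 - lam ^ (p * Suc m)) * fps_nth g (1 + p * Suc m)) = abv a * B m"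
    using dominant by (simp only:)
  then have step: "abv (1 - lam ^ (p * Suc m)) * B (Suc m) = abv a * B m"
    by (simp only: abv_mult lam B_def mult_1_left)
  have "abv a * B m < B (Suc m)"
  proof -
    have d: "abv (1 - lam ^ (p * Suc m)) < 1"
      using abv_one_minus_power_le[of lam "p * Suc m"] lam by linarith
    have "B (Suc m) \<noteq> 0" using step a_pos B_pos by auto
    then have "0 < B (Suc m)" by (simp add: B_def abv_nonneg order_less_le)
    then have "abv (1 - lam ^ (p * Suc m)) * B (Suc m) < 1 * B (Suc m)"
      using d by (rule mult_strict_right_mono[rotated])
    then show ?thesis by (simp only: step mult_1_left)
  qed
  then show ?case using step a_pos B_pos by (simp only: B_def) simp
qed

lemma coeff_times_small_divisors:
  "abv (fps_nth g (1 + p * m)) * (\<Prod>j=1..m. abv (1 - lam ^ (p * j))) = abv a ^ m"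
proof (induction m)
  case 0
  then show ?case using g1 by (simp add: abv_one)
next
  case (Suc m)
  let ?P = "\<Prod>j=1..m. abv (1 - lam ^ (p * j))"
  have "abv (fps_nth g (1 + p * Suc m)) * (\<Prod>j=1..Suc m. abv (1 - lam ^ (p * j)))
      = abv (1 - lam ^ (p * Suc m)) * abv (fps_nth g (1 + p * Suc m)) * ?P"
    by (simp only: prod.nat_ivl_Suc' mult_ac)
  also have "\<dots> = abv a * (abv (fps_nth g (1 + p * m)) * ?P)"
    using schroeder_dominant_term[of m] by (simp only: mult.assoc)
  finally show ?case using Suc.IH by (simp only: power_Suc)
qed

text \<open>
  Along \<open>n = 1 + p N\<close> with \<open>N = p\<^bsup>s\<^esup>\<close>, a bound \<open>|b\<^sub>n| \<le> C\<^bsup>n\<^esup>\<close> and the smallness of the divisors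
  give \<open>|a|\<^bsup>N\<^esup> \<le> (C\<^bsup>2p\<^esup> |1 - \<lambda>|\<^bsup>s\<^esup>)\<^bsup>N\<^esup>\<close>; taking \<open>N\<close>-th roots and letting
  \<open>s\<close> tend to infinity forces \<open>a = 0\<close>.
\<close>
lemma schroeder_no_exponential_bound:
  assumes "1 \<le> C"
  shows "\<exists>n\<ge>M. C ^ n < abv (fps_nth g n)"
proof (rule ccontr)
  assume "\<not> ?thesis"
  then have bound: "abv (fps_nth g n) \<le> C ^ n" if "n \<ge> M" for n
    using that by force
  define r where "r = abv (1 - lam)"
  have r: "0 \<le> r" "r < 1" using lam by (auto simp: r_def abv_nonneg)
  have a_pos: "0 < abv a"
    using a abv_eq_0_iff[of a] abv_nonneg[of a] by simp
  have key: "abv a \<le> C ^ (2 * p) * r ^ s" if "s \<ge> M" for s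
  proof -
    define N where "N = p ^ s"
    have "s < N" using p_gt_1 by (simp add: N_def power_gt_expt)
    have "N \<le> p * N" using p_gt_1 by simp
    have "1 + p * N \<ge> M" using that \<open>s < N\<close> \<open>N \<le> p * N\<close> by linarith
    have "abv a ^ N = abv (fps_nth g (1 + p * N)) * (\<Prod>j=1..N. abv (1 - lam ^ (p * j)))"
      by (simp only: coeff_times_small_divisors)
    also have "\<dots> \<le> C ^ (1 + p * N) * r ^ (s * N)"
      unfolding N_def r_def
      by (intro mult_mono prod_small_divisors_le lam bound prod_nonneg)
         (use \<open>1 + p * N \<ge> M\<close> assms in \<open>auto simp: N_def abv_nonneg\<close>)
    also have "\<dots> \<le> C ^ (2 * p * N) * r ^ (s * N)"
      using assms \<open>s < N\<close> \<open>N \<le> p * N\<close> r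
      by (intro mult_right_mono power_increasing) auto
    also have "\<dots> = (C ^ (2 * p) * r ^ s) ^ N"
      by (simp add: power_mult power_mult_distrib)
    finally show ?thesis
      using assms r \<open>s < N\<close> by (subst (asm) power_mono_iff) (auto simp: abv_nonneg)
  qed
  have "(\<lambda>s. C ^ (2 * p) * r ^ s) \<longlonglongrightarrow> C ^ (2 * p) * 0"
    using r by (intro tendsto_mult tendsto_const LIMSEQ_power_zero) auto
  then have "abv a \<le> C ^ (2 * p) * 0"
    by (rule LIMSEQ_le_const) (use key in blast)
  then show False using a_pos by simp
qed

end

end

lemma conv_radius_pos_exponential_bound:
  fixes c :: "nat \<Rightarrow> real"
  assumes "0 < conv_radius c"
  obtains C M where "1 \<le> C" and "\<And>n. n \<ge> M \<Longrightarrow> \<bar>c n\<bar> \<le> C ^ n"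
proof -
  obtain r :: real where r: "0 < r" "ereal r < conv_radius c"
    using ereal_dense2[OF assms] by (metis ereal_less(2))
  then have "summable (\<lambda>n. c n * r ^ n)"
    by (intro summable_in_conv_radius) simp
  then have "(\<lambda>n. c n * r ^ n) \<longlonglongrightarrow> 0" by (rule summable_LIMSEQ_zero)
  from LIMSEQ_D[OF this, of 1] obtain M where M: "\<bar>c n * r ^ n\<bar> < 1" if "n \<ge> M" for n
    by auto
  show thesis
  proof (rule that[of "max 1 (1 / r)" M])
    fix n assume "n \<ge> M"
    then have "\<bar>c n\<bar> \<le> (1 / r) ^ n"
      using M[of n] r by (simp add: abs_mult field_simps power_divide)
    also have "\<dots> \<le> max 1 (1 / r) ^ n"
      using r by (intro power_mono) auto
    finally show "\<bar>c n\<bar> \<le> max 1 (1 / r) ^ n" .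
  qed simp
qed

theorem theorem2:
  fixes abv :: "'a::field \<Rightarrow> real" and lam a :: 'a and p :: nat
  assumes "CHAR('a) = p" and "p > 0"
    and "absolute_value abv" and "nontrivial_abv abv" and "complete_abv abv"
    and "abv lam = 1"
    and "a \<noteq> 0"
    and "abv (1 - lam) < 1"
  shows "\<not> analytically_linearizable abv (fps_of_poly (monom lam 1 + monom a (p + 1)))"
proof
  let ?f = "fps_of_poly (monom lam 1 + monom a (p + 1))"
  assume "analytically_linearizable abv ?f"
  then obtain g where g: "fps_nth g 1 = 1" "0 < abv_conv_radius abv g"
      "g oo ?f = fps_const (fps_nth ?f 1) * g"
    unfolding analytically_linearizable_def by blast
  interpret absolute_value abv by fact
  have "prime p" using prime_CHAR_semidom[where ?'a = 'a] assms(1,2) by simp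
  then interpret prime_char_absolute_value abv p
    by unfold_locales (use assms(1) in auto)
  have f: "?f = fps_const lam * fps_X + fps_const a * fps_X ^ (p + 1)"
    by (simp only: fps_of_poly_add fps_of_poly_monom power_one_right)
  have "fps_nth ?f 1 = lam" using assms(2) by simp
  with g(3) have eq:
    "g oo (fps_const lam * fps_X + fps_const a * fps_X ^ (p + 1)) = fps_const lam * g"
    by (simp only: f)
  obtain C M where C: "1 \<le> C" and bound: "\<And>n. n \<ge> M \<Longrightarrow> \<bar>abv (fps_nth g n)\<bar> \<le> C ^ n"
    using g(2) unfolding abv_conv_radius_def by (rule conv_radius_pos_exponential_bound) blast
  obtain n where "n \<ge> M" "C ^ n < abv (fps_nth g n)"
    using schroeder_no_exponential_bound[OF assms(6,8,7) g(1) eq C] by blast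
  with bound[of n] show False by simp
qed

end
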